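(* Let $L\subset C^\omega[0,1]$ be a $(d+1)$-dimensional linear space of functions and let $n$ be a prime power. Then there exist distinct $f_1,\dots,f_n\in L$ such that the upper envelope $$g(x)=\max\{f_1(x),\dots,f_n(x)\},\qquad x\in[0,1],$$ has at least $d(n-1)$ non-analytic points.
   Context: $C^\omega[0,1]$ denotes the space of real-valued real-analytic functions on the segment $[0,1]$. A non-analytic point of $g$ (a "switch point") is a point of $[0,1]$ at which $g$ is not real-analytic; these are exactly the points where the maximum in $g$ changes from $f_i$ to $f_j$ for some $i\ne j$. A prime power is a number $p^k$ with $p$ prime and $k\ge 1$ an integer. *)

theory Defs
  imports "HOL-Analysis.Analysis" "HOL-Number_Theory.Prime_Powers"
begin

text \<open>
  \<open>f\<close> is represented near \<open>x\<close> by a convergent power series centred at \<open>x\<close>, as a function on \<open>S\<close>.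
  At an endpoint of an interval \<open>S\<close> the representation is required on one side only; this amounts to
  \<open>f\<close> having a real-analytic extension to a neighbourhood of the endpoint.
\<close>
definition real_analytic_at_within :: "(real \<Rightarrow> real) \<Rightarrow> real \<Rightarrow> real set \<Rightarrow> bool" where
  "real_analytic_at_within f x S \<longleftrightarrow>
     (\<exists>r>0. \<exists>a. \<forall>y\<in>S. \<bar>y - x\<bar> < r \<longrightarrow> (\<lambda>k. a k * (y - x) ^ k) sums f y)"

definition real_analytic_on :: "(real \<Rightarrow> real) \<Rightarrow> real set \<Rightarrow> bool" where
  "real_analytic_on f S \<longleftrightarrow> (\<forall>x\<in>S. real_analytic_at_within f x S)"

definition non_analytic_points :: "(real \<Rightarrow> real) \<Rightarrow> real set" where
  "non_analytic_points g = {x \<in> {0..1}. \<not> real_analytic_at_within g x {0..1}}"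

lemma real_analytic_at_within_zero: "real_analytic_at_within (\<lambda>_. 0) x S"
  unfolding real_analytic_at_within_def
  by (intro exI[of _ 1] conjI exI[of _ "\<lambda>_. 0"]) auto

lemma real_analytic_at_within_add:
  assumes "real_analytic_at_within f x S" "real_analytic_at_within g x S"
  shows "real_analytic_at_within (\<lambda>y. f y + g y) x S"
proof -
  obtain r a where r: "r > 0" "\<And>y. y \<in> S \<Longrightarrow> \<bar>y - x\<bar> < r \<Longrightarrow> (\<lambda>k. a k * (y - x) ^ k) sums f y"
    using assms(1) unfolding real_analytic_at_within_def by blast
  obtain s b where s: "s > 0" "\<And>y. y \<in> S \<Longrightarrow> \<bar>y - x\<bar> < s \<Longrightarrow> (\<lambda>k. b k * (y - x) ^ k) sums g y"
    using assms(2) unfolding real_analytic_at_within_def by blast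
  have "(\<lambda>k. (a k + b k) * (y - x) ^ k) sums (f y + g y)"
    if "y \<in> S" "\<bar>y - x\<bar> < min r s" for y
    using sums_add[OF r(2) s(2), of y y] that by (simp add: distrib_right)
  then show ?thesis
    unfolding real_analytic_at_within_def using r(1) s(1)
    by (intro exI[of _ "min r s"] conjI exI[of _ "\<lambda>k. a k + b k"]) auto
qed

lemma real_analytic_at_within_cmult:
  assumes "real_analytic_at_within f x S"
  shows "real_analytic_at_within (\<lambda>y. c * f y) x S"
proof -
  obtain r a where r: "r > 0" "\<And>y. y \<in> S \<Longrightarrow> \<bar>y - x\<bar> < r \<Longrightarrow> (\<lambda>k. a k * (y - x) ^ k) sums f y"
    using assms unfolding real_analytic_at_within_def by blast
  have "(\<lambda>k. (c * a k) * (y - x) ^ k) sums (c * f y)" if "y \<in> S" "\<bar>y - x\<bar> < r" for y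
    using sums_mult[OF r(2), of y c] that by (simp add: mult.assoc)
  then show ?thesis
    unfolding real_analytic_at_within_def using r(1)
    by (intro exI[of _ r] conjI exI[of _ "\<lambda>k. c * a k"]) auto
qed

text \<open>
  The space $C^\omega[0,1]$. A function on \<open>[0,1]\<close> is encoded by its extension by zero to the real
  line, so that equality, linear independence and dimension refer to values on \<open>[0,1]\<close> only.
\<close>
typedef comega = "{f :: real \<Rightarrow> real. real_analytic_on f {0..1} \<and> (\<forall>x. x \<notin> {0..1} \<longrightarrow> f x = 0)}"
  morphisms apply_comega Abs_comega
  by (rule exI[of _ "\<lambda>_. 0"]) (simp add: real_analytic_on_def real_analytic_at_within_zero)

setup_lifting type_definition_comega

instantiation comega :: real_vector
begin

lift_definition zero_comega :: comega is "\<lambda>_. 0"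
  by (simp add: real_analytic_on_def real_analytic_at_within_zero)

lift_definition plus_comega :: "comega \<Rightarrow> comega \<Rightarrow> comega" is "\<lambda>f g x. f x + g x"
  by (simp add: real_analytic_on_def real_analytic_at_within_add)

lift_definition scaleR_comega :: "real \<Rightarrow> comega \<Rightarrow> comega" is "\<lambda>c f x. c * f x"
  by (simp add: real_analytic_on_def real_analytic_at_within_cmult)

lift_definition uminus_comega :: "comega \<Rightarrow> comega" is "\<lambda>f x. - f x"
  using real_analytic_at_within_cmult[of _ _ _ "-1"] by (simp add: real_analytic_on_def)

lift_definition minus_comega :: "comega \<Rightarrow> comega \<Rightarrow> comega" is "\<lambda>f g x. f x - g x"
  using real_analytic_at_within_add[OF _ real_analytic_at_within_cmult[of _ _ _ "-1"]]
  by (simp add: real_analytic_on_def)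

instance
  by standard (transfer; simp add: fun_eq_iff algebra_simps)+

end

definition upper_envelope :: "nat \<Rightarrow> (nat \<Rightarrow> comega) \<Rightarrow> real \<Rightarrow> real" where
  "upper_envelope n f x = Max ((\<lambda>i. apply_comega (f i) x) ` {1..n})"

end

theory Submission
  imports Defs
begin

text \<open>
  Everything happens near \<open>0\<close>. Ordering elements of \<open>L\<close> by their vanishing order at \<open>0\<close> and adding
  them up with rapidly decreasing coefficients, starting from the highest order, gives for every small
  \<open>v > 0\<close> some \<open>h \<in> L\<close> that is negative on a fixed interval to the right of \<open>v\<close>, changes sign \<open>d\<close> times
  in \<open>(0, v)\<close> and has constant sign further to the left. If \<open>f\<^sub>i\<close> is the strict maximum of
  \<open>f\<^sub>1, \<dots>, f\<^sub>n\<close> on \<open>(0, v]\<close>, then \<open>f\<^sub>n\<^sub>+\<^sub>1 = f\<^sub>i + h\<close> leaves the envelope unchanged to the right of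
  \<open>v\<close>, while the maximum alternates between \<open>f\<^sub>i\<close> and \<open>f\<^sub>n\<^sub>+\<^sub>1\<close> inside \<open>(0, v)\<close>: this creates \<open>d\<close> new
  switches, and again one function dominates near \<open>0\<close>. Between two points with different strict
  maximisers the identity theorem forces a non-analytic point.
\<close>

section \<open>Power series expansions and the identity theorem\<close>

text \<open>Once the first \<open>k\<close> coefficients vanish, division by \<open>t ^ k\<close>
  leaves a power series with constant term \<open>a k\<close>, and a power series is continuous at
  its centre.\<close>

lemma powser_leading_term:
  fixes a :: "nat \<Rightarrow> real"
  assumes "0 < r" "\<And>t. \<bar>t\<bar> < r \<Longrightarrow> (\<lambda>n. a n * t ^ n) sums F t" "\<And>j. j < k \<Longrightarrow> a j = 0"
  shows "((\<lambda>t. F t / t ^ k) \<longlongrightarrow> a k) (at 0)"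
proof -
  have "(\<lambda>n. a (n + k) * t ^ n) sums (F t / t ^ k)" if "t \<noteq> 0" "norm t < r" for t
  proof -
    have "(\<lambda>n. a (n + k) * t ^ (n + k)) sums (F t - (\<Sum>i<k. a i * t ^ i))"
      using assms(2)[of t] that by (intro sums_split_initial_segment) auto
    also have "(\<Sum>i<k. a i * t ^ i) = 0"
      by (simp add: assms(3))
    finally have "(\<lambda>n. a (n + k) * t ^ (n + k) / t ^ k) sums (F t / t ^ k)"
      by (intro sums_divide) simp
    then show ?thesis
      using that by (simp add: power_add)
  qed
  from powser_limit_0_strong[OF \<open>0 < r\<close> this] show ?thesis
    by simp
qed

text \<open>The definition gives convergence only at points of [0,1], hence on one side at an
  endpoint. Convergence at a single point at distance q already implies convergence for all |t| < q,
  so \<open>F\<close> lives on a two-sided neighbourhood of 0.\<close>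

lemma real_analytic_at_withinE:
  assumes "real_analytic_at_within f x {0..1}" "x \<in> {0..1}"
  obtains r a F where "0 < r" "\<And>t. \<bar>t\<bar> < r \<Longrightarrow> (\<lambda>n. a n * t ^ n) sums F t"
    "\<And>y. y \<in> {0..1} \<Longrightarrow> \<bar>y - x\<bar> < r \<Longrightarrow> f y = F (y - x)"
proof -
  obtain r a where r: "r > 0" "\<And>y. y \<in> {0..1} \<Longrightarrow> \<bar>y - x\<bar> < r \<Longrightarrow> (\<lambda>k. a k * (y - x) ^ k) sums f y"
    using assms(1) unfolding real_analytic_at_within_def by blast
  define F where "F t = (\<Sum>n. a n * t ^ n)" for t
  \<comment> \<open>Below the radius \<open>r\<close>, and small enough that a step of length
    \<open>q\<close> towards the farther endpoint stays in [0,1].\<close>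
  define q where "q = min r 1 / 4"
  define y where "y = (if x \<le> 1/2 then x + q else x - q)"
  have q: "0 < q" "q < r" "q \<le> 1/4"
    using r(1) unfolding q_def by auto
  have y: "y \<in> {0..1}" "\<bar>y - x\<bar> = q"
    using q assms(2) unfolding y_def by auto
  have s: "summable (\<lambda>n. a n * (y - x) ^ n)"
    using r(2)[OF y(1)] y q by (simp add: sums_iff)
  show ?thesis
  proof
    show "0 < q" by fact
    show "(\<lambda>n. a n * t ^ n) sums F t" if "\<bar>t\<bar> < q" for t
      unfolding F_def using powser_inside[OF s] that y by (simp add: summable_sums)
    show "f z = F (z - x)" if "z \<in> {0..1}" "\<bar>z - x\<bar> < q" for z
      using r(2)[of z] that q unfolding F_def by (simp add: sums_iff)
  qed
qed

lemma tendsto_at_within_shift: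
  fixes x :: real
  assumes "(G \<longlongrightarrow> l) (at 0)" "0 < r" "\<And>y. y \<in> S \<Longrightarrow> \<bar>y - x\<bar> < r \<Longrightarrow> g y = G (y - x)"
  shows "(g \<longlongrightarrow> l) (at x within S)"
proof -
  have "((\<lambda>y. G (y - x)) \<longlongrightarrow> l) (at x)"
    using LIM_offset[OF assms(1), of "- x"] by simp
  then have "((\<lambda>y. G (y - x)) \<longlongrightarrow> l) (at x within S)"
    by (rule tendsto_within_subset) simp
  moreover have "\<forall>\<^sub>F y in at x within S. G (y - x) = g y"
    unfolding eventually_at using assms(2,3) by (intro exI[of _ r]) (auto simp: dist_real_def)
  ultimately show ?thesis
    by (rule Lim_transform_eventually)
qed

lemma real_analytic_imp_continuous:
  assumes "real_analytic_at_within f x {0..1}" "x \<in> {0..1}"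
  shows "continuous (at x within {0..1}) f"
proof -
  obtain r a F where F: "0 < r" "\<And>t. \<bar>t\<bar> < r \<Longrightarrow> (\<lambda>n. a n * t ^ n) sums F t"
    "\<And>y. y \<in> {0..1} \<Longrightarrow> \<bar>y - x\<bar> < r \<Longrightarrow> f y = F (y - x)"
    by (rule real_analytic_at_withinE[OF assms]) blast
  have "(F \<longlongrightarrow> a 0) (at 0)"
    using powser_leading_term[OF F(1,2), of 0] by simp
  then have "(f \<longlongrightarrow> a 0) (at x within {0..1})"
    using F(1,3) by (rule tendsto_at_within_shift)
  moreover have "f x = a 0"
    using F(2)[of 0] F(3)[of x] F(1) assms(2) by (simp add: powser_sums_zero_iff)
  ultimately show ?thesis
    by (simp add: continuous_within)
qed

text \<open>Either all coefficients at \<open>x\<close> vanish, or the first nonzero one is the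
  limit; its index \<open>k\<close> is the vanishing order at \<open>x\<close>.\<close>

lemma real_analytic_leading_term:
  assumes "real_analytic_at_within f x {0..1}" "x \<in> {0..1}"
  shows "(\<exists>\<delta>>0. \<forall>y\<in>{0..1}. \<bar>y - x\<bar> < \<delta> \<longrightarrow> f y = 0) \<or>
         (\<exists>k c. c \<noteq> 0 \<and> ((\<lambda>y. f y / (y - x) ^ k) \<longlongrightarrow> c) (at x within {0..1}))"
proof -
  obtain r a F where F: "0 < r" "\<And>t. \<bar>t\<bar> < r \<Longrightarrow> (\<lambda>n. a n * t ^ n) sums F t"
    "\<And>y. y \<in> {0..1} \<Longrightarrow> \<bar>y - x\<bar> < r \<Longrightarrow> f y = F (y - x)"
    by (rule real_analytic_at_withinE[OF assms]) blast
  show ?thesis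
  proof (cases "\<forall>n. a n = 0")
    case True
    then have "F t = 0" if "\<bar>t\<bar> < r" for t
      using F(2)[OF that] by (simp add: sums_iff)
    with F(1,3) show ?thesis
      by (intro disjI1 exI[of _ r]) simp
  next
    case False
    define k where "k = (LEAST n. a n \<noteq> 0)"
    have k: "a k \<noteq> 0"
      unfolding k_def by (rule LeastI_ex) (use False in auto)
    have "a j = 0" if "j < k" for j
      using not_less_Least that unfolding k_def by blast
    then have "((\<lambda>t. F t / t ^ k) \<longlongrightarrow> a k) (at 0)"
      using powser_leading_term[OF F(1,2)] by blast
    then have "((\<lambda>y. f y / (y - x) ^ k) \<longlongrightarrow> a k) (at x within {0..1})"
      using F(1) by (rule tendsto_at_within_shift) (simp add: F(3))
    with k show ?thesis by blast
  qed
qed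

text \<open>Vanishing on a neighbourhood is a locally constant property: by the leading term
  dichotomy, near each point \<open>c\<close> it holds everywhere or nowhere. Connectedness of the
  segment carries it from \<open>p\<close> to \<open>q\<close>.\<close>

lemma real_analytic_identity:
  assumes ab: "0 \<le> a" "b \<le> 1"
    and an: "\<And>x. x \<in> {a..b} \<Longrightarrow> real_analytic_at_within f x {0..1}"
    and p: "p \<in> {a..b}" and q: "q \<in> {a..b}"
    and zero: "\<exists>\<delta>>0. \<forall>y\<in>{0..1}. \<bar>y - p\<bar> < \<delta> \<longrightarrow> f y = 0"
  shows "f q = 0"
proof -
  define P where "P x \<longleftrightarrow> (\<exists>\<delta>>0. \<forall>y\<in>{0..1}. \<bar>y - x\<bar> < \<delta> \<longrightarrow> f y = 0)" for x
  have "P q"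
  proof (rule connected_induction_simple[of "{a..b}" p q])
    show "connected {a..b}" by simp
    show "P p" using zero by (simp add: P_def)
    fix c assume c: "c \<in> {a..b}"
    then have c01: "c \<in> {0..1}" using ab by auto
    from real_analytic_leading_term[OF an[OF c] c01]
    have "\<exists>r>0. \<forall>x\<in>{0..1}. \<forall>y\<in>{0..1}. \<bar>x - c\<bar> < r \<and> \<bar>y - c\<bar> < r \<and> P x \<longrightarrow> P y"
    proof (elim disjE exE conjE)
      fix \<delta> :: real assume \<delta>: "\<delta> > 0" "\<forall>y\<in>{0..1}. \<bar>y - c\<bar> < \<delta> \<longrightarrow> f y = 0"
      have "P y" if "\<bar>y - c\<bar> < \<delta>" for y
        unfolding P_def using that \<delta> by (intro exI[of _ "\<delta> - \<bar>y - c\<bar>"]) auto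
      with \<delta>(1) show ?thesis by blast
    next
      fix k l assume l: "l \<noteq> (0::real)" and lim: "((\<lambda>y. f y / (y - c) ^ k) \<longlongrightarrow> l) (at c within {0..1})"
      from tendsto_imp_eventually_ne[OF lim l]
      have "\<forall>\<^sub>F y in at c within {0..1}. f y \<noteq> 0"
        by eventually_elim auto
      then obtain r where r: "r > 0" "\<And>y. y \<in> {0..1} \<Longrightarrow> y \<noteq> c \<Longrightarrow> \<bar>y - c\<bar> < r \<Longrightarrow> f y \<noteq> 0"
        by (auto simp: eventually_at dist_real_def)
      have "\<not> P x" if x: "x \<in> {0..1}" "\<bar>x - c\<bar> < r" for x
      proof
        assume "P x"
        then obtain \<delta> where \<delta>: "\<delta> > 0" "\<forall>y\<in>{0..1}. \<bar>y - x\<bar> < \<delta> \<longrightarrow> f y = 0"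
          unfolding P_def by blast
        show False
        proof (cases "x = c")
          case False
          then show False using r(2)[of x] x \<delta> by auto
        next
          case True
          \<comment> \<open>Nonvanishing is known only off \<open>c\<close>, so for
            \<open>x = c\<close> a nearby point \<open>y\<close> of [0,1] gives the
            contradiction.\<close>
          define e where "e = min (min \<delta> r) 1 / 4"
          have e: "e > 0" "e < \<delta>" "e < r" "e \<le> 1/4"
            unfolding e_def using \<delta>(1) r(1) by auto
          define y where "y = (if c \<le> 1/2 then c + e else c - e)"
          have "y \<in> {0..1}" "y \<noteq> c" "\<bar>y - c\<bar> = e"
            using e c01 unfolding y_def by auto
          then show False using r(2)[of y] \<delta>(2) e True by auto
        qed
      qed
      with r(1) show ?thesis by blast
    qed
    then obtain r where r: "r > 0" "\<forall>x\<in>{0..1}. \<forall>y\<in>{0..1}. \<bar>x - c\<bar> < r \<and> \<bar>y - c\<bar> < r \<and> P x \<longrightarrow> P y"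
      by blast
    show "\<exists>T. openin (top_of_set {a..b}) T \<and> c \<in> T \<and> (\<forall>x\<in>T. \<forall>y\<in>T. P x \<longrightarrow> P y)"
    proof (intro exI[of _ "{a..b} \<inter> ball c r"] conjI)
      show "openin (top_of_set {a..b}) ({a..b} \<inter> ball c r)"
        by (simp add: openin_open_Int)
      show "\<forall>x\<in>{a..b} \<inter> ball c r. \<forall>y\<in>{a..b} \<inter> ball c r. P x \<longrightarrow> P y"
      proof (intro ballI)
        fix x y assume "x \<in> {a..b} \<inter> ball c r" "y \<in> {a..b} \<inter> ball c r"
        with ab have "x \<in> {0..1}" "\<bar>x - c\<bar> < r" "y \<in> {0..1}" "\<bar>y - c\<bar> < r"
          by (auto simp: dist_real_def abs_minus_commute)
        with r(2) show "P x \<longrightarrow> P y" by blast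
      qed
    qed (use c r in auto)
  qed (use p q in auto)
  then obtain \<delta> where \<delta>: "\<delta> > 0" "\<forall>y\<in>{0..1}. \<bar>y - q\<bar> < \<delta> \<longrightarrow> f y = 0"
    unfolding P_def by blast
  then show ?thesis using q ab by auto
qed

section \<open>Elements of \<open>comega\<close> and their vanishing order at 0\<close>

lemma comega_analytic: "x \<in> {0..1} \<Longrightarrow> real_analytic_at_within (apply_comega f) x {0..1}"
  using apply_comega[of f] by (auto simp: real_analytic_on_def)

lemma comega_continuous_on: "continuous_on {0..1} (apply_comega f)"
  by (simp add: continuous_on_eq_continuous_within comega_analytic real_analytic_imp_continuous)

lemma apply_comega_simps [simp]:
  "apply_comega 0 x = 0"
  "apply_comega (f + g) x = apply_comega f x + apply_comega g x"
  "apply_comega (f - g) x = apply_comega f x - apply_comega g x"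
  "apply_comega (- f) x = - apply_comega f x"
  "apply_comega (c *\<^sub>R f) x = c * apply_comega f x"
  by (simp_all add: zero_comega.rep_eq plus_comega.rep_eq minus_comega.rep_eq uminus_comega.rep_eq
      scaleR_comega.rep_eq)

lemma comega_eqI: "(\<And>x. x \<in> {0..1} \<Longrightarrow> apply_comega f x = apply_comega g x) \<Longrightarrow> f = g"
  by transfer (rule ext, metis)

text \<open>By the identity theorem a nonzero element cannot vanish on a neighbourhood of 0, which
  leaves only the second alternative of the leading term dichotomy.\<close>

lemma comega_vanishing_order:
  assumes "f \<noteq> 0"
  obtains k c where "c \<noteq> 0" "((\<lambda>t. apply_comega f t / t ^ k) \<longlongrightarrow> c) (at_right 0)"
proof -
  have "\<not> (\<exists>\<delta>>0. \<forall>y\<in>{0..1}. \<bar>y - 0\<bar> < \<delta> \<longrightarrow> apply_comega f y = 0)"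
  proof
    assume *: "\<exists>\<delta>>0. \<forall>y\<in>{0..1}. \<bar>y - 0\<bar> < \<delta> \<longrightarrow> apply_comega f y = 0"
    have "apply_comega f x = 0" if "x \<in> {0..1}" for x
      by (rule real_analytic_identity[of 0 1 _ 0, OF _ _ comega_analytic _ that *]) auto
    then show False
      using assms comega_eqI[of f 0] by simp
  qed
  then obtain k c where "c \<noteq> 0"
      "((\<lambda>t. apply_comega f t / (t - 0) ^ k) \<longlongrightarrow> c) (at 0 within {0..1})"
    using real_analytic_leading_term[OF comega_analytic, of 0 f] by force
  then show ?thesis
    using that by (simp add: at_within_Icc_at_right)
qed

section \<open>Elements with prescribed sign changes near 0\<close>

lemma pos_near_zero:
  fixes g :: "real \<Rightarrow> real"
  assumes "((\<lambda>t. g t / t ^ k) \<longlongrightarrow> l) (at_right 0)" "0 < l"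
  obtains w where "0 < w" "w \<le> 1" "\<And>t. t \<in> {0<..w} \<Longrightarrow> 0 < g t"
proof -
  have "\<forall>\<^sub>F t in at_right 0. 0 < g t / t ^ k"
    using order_tendstoD(1)[OF assms] .
  then obtain b where b: "b > 0" "\<And>t. 0 < t \<Longrightarrow> t < b \<Longrightarrow> 0 < g t / t ^ k"
    by (auto simp: eventually_at_right_field)
  have "0 < g t" if "t \<in> {0<..min b 1 / 2}" for t
    using b(2)[of t] that by (auto simp: zero_less_divide_iff)
  then show ?thesis
    using that[of "min b 1 / 2"] b(1) by auto
qed

text \<open>
  The induction splits off an element \<open>f0\<close> of minimal vanishing order: the elements of higher order
  contain a subspace of dimension one less, and a small multiple of \<open>f0\<close> adds one sign change
  close to \<open>0\<close> without disturbing the earlier ones.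
\<close>
lemma exists_alternating:
  fixes B :: "comega set"
  assumes "independent B" "card B = Suc d"
  shows "\<exists>b\<in>{0<..1}. \<forall>v\<in>{0<..<b}. \<exists>h\<in>span B. \<exists>s :: nat \<Rightarrow> real.
    s 0 = v \<and> (\<forall>j<d. s (Suc j) < s j) \<and> (\<forall>j\<le>d. 0 < s j) \<and>
    (\<forall>t\<in>{v..b}. apply_comega h t < 0) \<and>
    (\<forall>j\<le>d. (-1) ^ j * apply_comega h (s j) < 0) \<and>
    (\<forall>t\<in>{0<..s d}. (-1) ^ d * apply_comega h t < 0)"
  using assms
proof (induction d arbitrary: B)
  case 0
  then obtain f where B: "B = {f}"
    by (metis One_nat_def card_1_singletonE)
  with 0 have "f \<noteq> 0" by auto
  then obtain k c where c: "c \<noteq> 0" "((\<lambda>t. apply_comega f t / t ^ k) \<longlongrightarrow> c) (at_right 0)"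
    by (rule comega_vanishing_order)
  \<comment> \<open>Scaling by \<open>c\<close> makes the leading coefficient a square, so
    \<open>- c\<close> times \<open>f\<close> is negative to the right of 0 whatever the sign of
    \<open>c\<close>.\<close>
  have "((\<lambda>t. c * apply_comega f t / t ^ k) \<longlongrightarrow> c * c) (at_right 0)"
    using tendsto_mult_left[OF c(2), of c] by simp
  then obtain w where w: "0 < w" "w \<le> 1" "\<And>t. t \<in> {0<..w} \<Longrightarrow> 0 < c * apply_comega f t"
    by (rule pos_near_zero) (use c(1) in \<open>auto simp: zero_less_mult_iff\<close>)
  have h: "(- c) *\<^sub>R f \<in> span B"
    unfolding B by (intro span_scale span_base) simp
  show ?case
  proof (intro bexI[of _ w] ballI)
    fix v assume v: "v \<in> {0<..<w}"
    show "\<exists>h\<in>span B. \<exists>s :: nat \<Rightarrow> real.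
        s 0 = v \<and> (\<forall>j<0. s (Suc j) < s j) \<and> (\<forall>j\<le>0. 0 < s j) \<and>
        (\<forall>t\<in>{v..w}. apply_comega h t < 0) \<and>
        (\<forall>j\<le>0. (-1) ^ j * apply_comega h (s j) < 0) \<and>
        (\<forall>t\<in>{0<..s 0}. (-1) ^ 0 * apply_comega h t < 0)"
      by (rule bexI[OF _ h], rule exI[of _ "\<lambda>_. v"]) (use v w(3) in auto)
  qed (use w in auto)
next
  case (Suc d)
  let ?lim = "\<lambda>k f l. ((\<lambda>t. apply_comega f t / t ^ k) \<longlongrightarrow> l) (at_right 0)"
  define V where "V = span B"
  have finB: "finite B" "B \<noteq> {}"
    using Suc.prems(2) card.infinite by fastforce+
  then obtain g where "g \<in> B" by blast
  with Suc.prems have "g \<in> V" "g \<noteq> 0"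
    unfolding V_def by (auto intro: span_base dest: dependent_zero)
  then have ex: "\<exists>k. \<exists>f\<in>V. \<exists>c. c \<noteq> 0 \<and> ?lim k f c"
    by (metis comega_vanishing_order)
  define k where "k = (LEAST k. \<exists>f\<in>V. \<exists>c. c \<noteq> 0 \<and> ?lim k f c)"
  obtain f0 c where f0: "f0 \<in> V" "c \<noteq> 0" "?lim k f0 c"
    using LeastI_ex[OF ex] unfolding k_def by blast
  \<comment> \<open>All vanishing orders in \<open>V\<close> are at least \<open>k\<close>, so every
    element of \<open>V\<close> has a coefficient of order \<open>k\<close>, possibly 0.\<close>
  have lim_ex: "\<exists>l. ?lim k f l" if "f \<in> V" for f
  proof (cases "f = 0")
    case False
    then obtain k' c' where c': "c' \<noteq> 0" "?lim k' f c'"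
      by (rule comega_vanishing_order)
    then have "k \<le> k'"
      unfolding k_def using that by (intro Least_le) blast
    have "((\<lambda>t. apply_comega f t / t ^ k' * t ^ (k' - k)) \<longlongrightarrow> c' * 0 ^ (k' - k)) (at_right 0)"
      by (intro tendsto_intros c')
    moreover have "\<forall>\<^sub>F t in at_right 0. apply_comega f t / t ^ k' * t ^ (k' - k) = apply_comega f t / t ^ k"
      using eventually_at_right_less[of 0]
      by eventually_elim (use \<open>k \<le> k'\<close> in \<open>simp add: power_diff\<close>)
    ultimately show ?thesis
      by (intro exI) (rule Lim_transform_eventually)
  qed (intro exI[of _ 0], simp)
  \<comment> \<open>The kernel of the linear functional on \<open>V\<close> that takes this
    coefficient; it consists of 0 and the elements of order above \<open>k\<close>.\<close>
  define V' where "V' = {f \<in> V. ?lim k f 0}"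
  have subV: "subspace V'"
    unfolding subspace_def
  proof (intro conjI ballI allI)
    show "0 \<in> V'" by (simp add: V'_def V_def span_zero)
    show "x + y \<in> V'" if "x \<in> V'" "y \<in> V'" for x y
      using that tendsto_add[of "\<lambda>t. apply_comega x t / t ^ k" 0 "at_right 0" "\<lambda>t. apply_comega y t / t ^ k" 0]
      by (auto simp: V'_def V_def span_add add_divide_distrib)
    show "a *\<^sub>R x \<in> V'" if "x \<in> V'" for x a
      using that tendsto_mult_left[of "\<lambda>t. apply_comega x t / t ^ k" 0 "at_right 0" a]
      by (auto simp: V'_def V_def span_scale)
  qed
  \<comment> \<open>Dimension count: subtracting a multiple of \<open>f0\<close> moves any element
    of \<open>V\<close> into \<open>V'\<close>, so a basis of \<open>V'\<close> together with
    \<open>f0\<close> spans \<open>V\<close> and has at least \<open>card B\<close>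
    elements.\<close>
  obtain B' where B': "B' \<subseteq> V'" "independent B'" "V' \<subseteq> span B'"
    using maximal_independent_subset by blast
  have V: "V \<subseteq> span (insert f0 B')"
  proof
    fix f assume f: "f \<in> V"
    then obtain l where l: "?lim k f l" using lim_ex by blast
    have "f - (l / c) *\<^sub>R f0 \<in> V'"
      using f f0(1) tendsto_diff[OF l tendsto_mult_left[OF f0(3), of "l / c"]] \<open>c \<noteq> 0\<close>
      by (simp add: V'_def V_def span_diff span_scale diff_divide_distrib)
    with B'(3) have *: "f - (l / c) *\<^sub>R f0 \<in> span B'" by blast
    show "f \<in> span (insert f0 B')"
      unfolding span_insert using * by blast
  qed
  have "B' \<subseteq> span B"
    using B'(1) by (auto simp: V'_def V_def)
  then have finB': "finite B'"
    using independent_span_bound[OF finB(1) B'(2)] by blast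
  have "card B \<le> card (insert f0 B')"
    using independent_span_bound[of "insert f0 B'" B] finB' Suc.prems(1) V span_superset[of B]
    unfolding V_def by auto
  also have "\<dots> \<le> Suc (card B')"
    using finB' by (simp add: card_insert_if)
  finally have "Suc d \<le> card B'"
    using Suc.prems(2) by simp
  then obtain C where C: "C \<subseteq> B'" "card C = Suc d"
    by (meson obtain_subset_with_card_n)
  have spanC: "span C \<subseteq> V'"
    using C(1) B'(1) subV by (intro span_minimal) auto
  obtain b where b: "0 < b" "b \<le> 1" and IH: "\<forall>v\<in>{0<..<b}. \<exists>h\<in>span C. \<exists>s :: nat \<Rightarrow> real.
      s 0 = v \<and> (\<forall>j<d. s (Suc j) < s j) \<and> (\<forall>j\<le>d. 0 < s j) \<and>
      (\<forall>t\<in>{v..b}. apply_comega h t < 0) \<and>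
      (\<forall>j\<le>d. (-1) ^ j * apply_comega h (s j) < 0) \<and>
      (\<forall>t\<in>{0<..s d}. (-1) ^ d * apply_comega h t < 0)"
    using Suc.IH[OF independent_mono[OF B'(2) C(1)] C(2)] by auto
  show ?case
  proof (intro bexI[of _ b] ballI)
    fix v assume v: "v \<in> {0<..<b}"
    \<comment> \<open>The sign of \<open>h'\<close> on all of (0, s d] is dropped here: close to 0
      the term from \<open>f0\<close> will decide the sign.\<close>
    obtain h' and s :: "nat \<Rightarrow> real" where h': "h' \<in> span C" and s: "s 0 = v"
      "\<And>j. j < d \<Longrightarrow> s (Suc j) < s j" "\<And>j. j \<le> d \<Longrightarrow> 0 < s j"
      "\<And>t. t \<in> {v..b} \<Longrightarrow> apply_comega h' t < 0"
      "\<And>j. j \<le> d \<Longrightarrow> (-1) ^ j * apply_comega h' (s j) < 0"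
      using bspec[OF IH v] by (elim bexE exE conjE) blast
    have s_le: "s j \<le> v" if "j \<le> d" for j
      using that
    proof (induction j)
      case (Suc j)
      then show ?case using s(2)[of j] by simp
    qed (simp add: s(1))
    \<comment> \<open>The compact set on which the signs of \<open>h'\<close> must survive the
      perturbation. As \<open>h'\<close> has no zero there, the quotient of \<open>f0\<close> by
      \<open>h'\<close> is bounded on it.\<close>
    define K where "K = {v..b} \<union> s ` {..d}"
    have "s j \<in> {0..1}" if "j \<le> d" for j
      using s_le[OF that] s(3)[OF that] v b by auto
    then have K: "compact K" "K \<subseteq> {0..1}"
      unfolding K_def using v b by (auto intro: compact_Un finite_imp_compact)
    have K0: "apply_comega h' t \<noteq> 0" if "t \<in> K" for t
    proof -
      have "apply_comega h' (s j) \<noteq> 0" if "j \<le> d" for j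
        using s(5)[OF that] by auto
      moreover have "apply_comega h' t \<noteq> 0" if "t \<in> {v..b}" for t
        using s(4)[OF that] by auto
      ultimately show ?thesis
        using that unfolding K_def by blast
    qed
    have "continuous_on K (\<lambda>t. apply_comega f0 t / apply_comega h' t)"
      using K(2) K0 by (intro continuous_on_divide continuous_on_subset[OF comega_continuous_on]) auto
    then have "bounded ((\<lambda>t. apply_comega f0 t / apply_comega h' t) ` K)"
      using K(1) by (intro compact_imp_bounded compact_continuous_image)
    then obtain M where M: "M > 0" "\<And>t. t \<in> K \<Longrightarrow> \<bar>apply_comega f0 t / apply_comega h' t\<bar> \<le> M"
      by (auto simp: bounded_pos)
    \<comment> \<open>The sign makes \<open>e\<close> times \<open>f0\<close> have sign (-1)^d just
      right of 0, opposite to the sign of \<open>h'\<close> at \<open>s d\<close>; this is the new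
      sign change. The denominator \<open>M + 1\<close> instead of \<open>M\<close> makes the
      perturbation strictly smaller than \<open>h'\<close> on \<open>K\<close>.\<close>
    define e where "e = (-1) ^ d * sgn c / (M + 1)"
    have e_abs: "\<bar>e\<bar> = 1 / (M + 1)"
      using M(1) f0(2) by (simp add: e_def abs_mult power_abs abs_sgn_eq)
    have small: "\<bar>e * apply_comega f0 t\<bar> < \<bar>apply_comega h' t\<bar>" if "t \<in> K" for t
    proof -
      have "\<bar>apply_comega f0 t\<bar> \<le> M * \<bar>apply_comega h' t\<bar>"
        using M(2)[OF that] K0[OF that] by (simp add: abs_divide divide_le_eq)
      also have "\<dots> < (M + 1) * \<bar>apply_comega h' t\<bar>"
        using K0[OF that] by (simp add: algebra_simps)
      finally show ?thesis
        using M(1) by (simp add: abs_mult e_abs divide_less_eq mult.commute)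
    qed
    define h where "h = h' + e *\<^sub>R f0"
    have hV: "h \<in> span B"
      using h' spanC f0(1) unfolding h_def V'_def V_def by (auto intro: span_add span_scale)
    have sign: "apply_comega h t < 0 \<longleftrightarrow> apply_comega h' t < 0"
      "apply_comega h t > 0 \<longleftrightarrow> apply_comega h' t > 0" if "t \<in> K" for t
      using small[OF that] by (auto simp: h_def)
    \<comment> \<open>Since \<open>h'\<close> is of smaller size than t^k at 0, the leading
      coefficient of \<open>h\<close> at order \<open>k\<close> is \<open>e * c\<close>, which fixes
      its sign near 0.\<close>
    have "?lim k h' 0" using h' spanC by (auto simp: V'_def)
    then have "((\<lambda>t. - ((-1) ^ Suc d) * (apply_comega h' t / t ^ k + e * (apply_comega f0 t / t ^ k)))
        \<longlongrightarrow> - ((-1) ^ Suc d) * (0 + e * c)) (at_right 0)"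
      by (intro tendsto_intros f0)
    moreover have "- ((-1) ^ Suc d) * (apply_comega h' t / t ^ k + e * (apply_comega f0 t / t ^ k)) =
        (- ((-1) ^ Suc d) * apply_comega h t) / t ^ k" for t
      by (simp add: h_def add_divide_distrib algebra_simps)
    moreover have "- ((-1) ^ Suc d) * (0 + e * c) = \<bar>c\<bar> / (M + 1)"
      by (simp add: e_def abs_sgn mult_ac flip: power_add)
    ultimately have "((\<lambda>t. (- ((-1) ^ Suc d) * apply_comega h t) / t ^ k) \<longlongrightarrow> \<bar>c\<bar> / (M + 1)) (at_right 0)"
      by (simp only:)
    then obtain w where w: "0 < w" "w \<le> 1"
        "\<And>t. t \<in> {0<..w} \<Longrightarrow> 0 < - ((-1) ^ Suc d) * apply_comega h t"
      by (rule pos_near_zero) (use f0(2) M(1) in auto)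
    \<comment> \<open>The new sample point: left of \<open>s d\<close>, and inside the interval (0,
      w] where the sign of \<open>h\<close> is known.\<close>
    define z where "z = min w (s d) / 2"
    have z: "0 < z" "z < w" "z < s d"
      unfolding z_def using w(1) s(3)[of d] by auto
    define s' where "s' = s(Suc d := z)"
    show "\<exists>h\<in>span B. \<exists>s :: nat \<Rightarrow> real.
        s 0 = v \<and> (\<forall>j<Suc d. s (Suc j) < s j) \<and> (\<forall>j\<le>Suc d. 0 < s j) \<and>
        (\<forall>t\<in>{v..b}. apply_comega h t < 0) \<and>
        (\<forall>j\<le>Suc d. (-1) ^ j * apply_comega h (s j) < 0) \<and>
        (\<forall>t\<in>{0<..s (Suc d)}. (-1) ^ Suc d * apply_comega h t < 0)"
    proof (intro bexI[OF _ hV] exI[of _ s'] conjI allI impI ballI)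
      show "s' 0 = v" using s(1) by (simp add: s'_def)
      show "s' (Suc j) < s' j" if "j < Suc d" for j
        using that z s(2)[of j] by (auto simp: s'_def less_Suc_eq)
      show "0 < s' j" if "j \<le> Suc d" for j
        using that z s(3)[of j] by (auto simp: s'_def le_Suc_eq)
      show "apply_comega h t < 0" if "t \<in> {v..b}" for t
        using that s(4)[of t] sign(1)[of t] by (simp add: K_def)
      show last: "(-1) ^ Suc d * apply_comega h t < 0" if "t \<in> {0<..s' (Suc d)}" for t
        using that w(3)[of t] z by (simp add: s'_def)
      show "(-1) ^ j * apply_comega h (s' j) < 0" if "j \<le> Suc d" for j
      proof (cases "j = Suc d")
        case True
        then show ?thesis using last[of z] z by (simp add: s'_def)
      next
        case False
        with that have "j \<le> d" by simp
        with s(5)[of j] sign[of "s j"] show ?thesis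
          by (cases "even j") (auto simp: s'_def K_def)
      qed
    qed
  qed (use b in auto)
qed

section \<open>Envelopes whose strict maximiser alternates\<close>

definition strict_max_at :: "nat \<Rightarrow> (nat \<Rightarrow> comega) \<Rightarrow> nat \<Rightarrow> real \<Rightarrow> bool" where
  "strict_max_at n f i t \<longleftrightarrow> i \<in> {1..n} \<and>
     (\<forall>j\<in>{1..n} - {i}. apply_comega (f j) t < apply_comega (f i) t)"

text \<open>The new function lies below \<open>f k\<close> at \<open>t\<close>, hence below the
  maximum. The index \<open>k\<close> may differ from \<open>i\<close>: the copied function need not
  be the maximiser at \<open>t\<close>.\<close>

lemma strict_max_at_add_below:
  assumes "strict_max_at n f i t" "k \<in> {1..n}" "apply_comega h t < 0"
  shows "strict_max_at (Suc n) (f(Suc n := f k + h)) i t"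
proof -
  have "apply_comega (f k) t \<le> apply_comega (f i) t"
    using assms(1,2) by (cases "k = i") (auto simp: strict_max_at_def less_imp_le)
  then show ?thesis
    using assms by (auto simp: strict_max_at_def)
qed

lemma strict_max_at_add_above:
  assumes "strict_max_at n f i t" "0 < apply_comega h t"
  shows "strict_max_at (Suc n) (f(Suc n := f i + h)) (Suc n) t"
proof -
  have "apply_comega (f j) t \<le> apply_comega (f i) t" if "j \<in> {1..n}" for j
    using assms(1) that by (cases "j = i") (auto simp: strict_max_at_def less_imp_le)
  then show ?thesis
    using assms by (force simp: strict_max_at_def)
qed

lemma strict_descent:
  fixes x :: "nat \<Rightarrow> real"
  assumes "\<And>k. k < m \<Longrightarrow> x (Suc k) < x k" "k \<le> l" "l \<le> m"
  shows "x l \<le> x k"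
  using assms(2,3)
proof (induction l rule: dec_induct)
  case (step l)
  then show ?case using assms(1)[of l] by simp
qed simp

text \<open>Supplies d (n - 1) + 1 decreasing sample points with different strict maximisers at
  consecutive ones, so that each of the d (n - 1) gaps will contain a switch. Each function after
  the first contributes \<open>d\<close> gaps.\<close>

lemma exists_alternating_envelope:
  assumes "subspace L" "B \<subseteq> L" "independent B" "card B = Suc d" "1 \<le> d" "1 \<le> n"
  shows "\<exists>f x idx. (\<forall>i\<in>{1..n}. f i \<in> L) \<and> inj_on f {1..n} \<and>
    (\<forall>k\<le>d * (n - 1). x k \<in> {0<..<1} \<and> strict_max_at n f (idx k) (x k)) \<and>
    (\<forall>k<d * (n - 1). x (Suc k) < x k \<and> idx (Suc k) \<noteq> idx k)"
proof -
  obtain b where b: "0 < b" "b \<le> 1" and alt: "\<forall>v\<in>{0<..<b}. \<exists>h\<in>span B. \<exists>s :: nat \<Rightarrow> real.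
      s 0 = v \<and> (\<forall>j<d. s (Suc j) < s j) \<and> (\<forall>j\<le>d. 0 < s j) \<and>
      (\<forall>t\<in>{v..b}. apply_comega h t < 0) \<and>
      (\<forall>j\<le>d. (-1) ^ j * apply_comega h (s j) < 0) \<and>
      (\<forall>t\<in>{0<..s d}. (-1) ^ d * apply_comega h t < 0)"
    using exists_alternating[OF assms(3,4)] by auto
  \<comment> \<open>The induction carries two additions: the samples stay below \<open>b\<close>, so
    that the alternating \<open>h\<close> can start at the last one, and a single function dominates
    all the way from the last sample to 0.\<close>
  have "\<exists>f x idx. (\<forall>i\<in>{1..n}. f i \<in> L) \<and> inj_on f {1..n} \<and>
    (\<forall>k\<le>d * (n - 1). x k \<in> {0<..<b} \<and> strict_max_at n f (idx k) (x k)) \<and>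
    (\<forall>k<d * (n - 1). x (Suc k) < x k \<and> idx (Suc k) \<noteq> idx k) \<and>
    (\<forall>t\<in>{0<..x (d * (n - 1))}. strict_max_at n f (idx (d * (n - 1))) t)"
    using assms(6)
  proof (induction n rule: dec_induct)
    case base
    show ?case
      using b(1) assms(1) by (intro exI[of _ "\<lambda>_. 0"] exI[of _ "\<lambda>_. b / 2"] exI[of _ "\<lambda>_. 1"])
        (auto simp: strict_max_at_def subspace_0)
  next
    case (step n)
    define m where "m = d * (n - 1)"
    have m: "d * (Suc n - 1) = m + d"
      using step.hyps by (cases n) (auto simp: m_def)
    obtain f x idx where f: "\<And>i. i \<in> {1..n} \<Longrightarrow> f i \<in> L" "inj_on f {1..n}"
      and x: "\<And>k. k \<le> m \<Longrightarrow> x k \<in> {0<..<b}" "\<And>k. k \<le> m \<Longrightarrow> strict_max_at n f (idx k) (x k)"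
      and dec: "\<And>k. k < m \<Longrightarrow> x (Suc k) < x k" "\<And>k. k < m \<Longrightarrow> idx (Suc k) \<noteq> idx k"
      and dom: "\<And>t. t \<in> {0<..x m} \<Longrightarrow> strict_max_at n f (idx m) t"
      using step.IH unfolding m_def by (elim exE conjE) blast
    obtain h and s :: "nat \<Rightarrow> real" where h: "h \<in> span B" and s: "s 0 = x m"
      "\<And>j. j < d \<Longrightarrow> s (Suc j) < s j" "\<And>j. j \<le> d \<Longrightarrow> 0 < s j"
      "\<And>t. t \<in> {x m..b} \<Longrightarrow> apply_comega h t < 0"
      "\<And>j. j \<le> d \<Longrightarrow> (-1) ^ j * apply_comega h (s j) < 0"
      "\<And>t. t \<in> {0<..s d} \<Longrightarrow> (-1) ^ d * apply_comega h t < 0"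
      using bspec[OF alt x(1)[OF order_refl]] by (elim bexE exE conjE) blast
    have idxm: "idx m \<in> {1..n}"
      using x(2)[of m] by (simp add: strict_max_at_def)
    have s_le: "s j \<le> x m" if "j \<le> d" for j
      using strict_descent[of d s 0 j, OF s(2)] s(1) that by simp
    have x_ge: "x m \<le> x k" if "k \<le> m" for k
      using strict_descent[of m x k m, OF dec(1)] that by simp
    \<comment> \<open>The alternation of \<open>h\<close> starts at \<open>s 0 = x m\<close>, so
      \<open>s 1\<close> to \<open>s d\<close> are the new samples. At \<open>s j\<close> the sign
      of \<open>h\<close> is - (-1)^j, so the new function wins exactly for odd
      \<open>j\<close>.\<close>
    define f' where "f' = f(Suc n := f (idx m) + h)"
    define x' where "x' k = (if k \<le> m then x k else s (k - m))" for k
    define idx' where "idx' k = (if k \<le> m then idx k else if odd (k - m) then Suc n else idx m)" for k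
    have dom': "strict_max_at (Suc n) f' (if odd j then Suc n else idx m) t"
      if "t \<in> {0<..x m}" "(-1) ^ j * apply_comega h t < 0" for t j
    proof (cases "odd j")
      case True
      then show ?thesis
        using strict_max_at_add_above[OF dom[OF that(1)], of h] that(2) by (simp add: f'_def)
    next
      case False
      then show ?thesis
        using strict_max_at_add_below[OF dom[OF that(1)] idxm, of h] that(2) by (simp add: f'_def)
    qed
    have hL: "h \<in> L"
      using h span_minimal[OF assms(2,1)] by blast
    have f'L: "f' i \<in> L" if "i \<in> {1..Suc n}" for i
    proof (cases "i = Suc n")
      case True
      then show ?thesis
        using subspace_add[OF assms(1) f(1)[OF idxm] hL] by (simp add: f'_def)
    qed (use that f(1) in \<open>auto simp: f'_def\<close>)
    \<comment> \<open>The new function is distinct from the old ones because it strictly exceeds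
      them at \<open>s 1\<close>; this point exists since d is at least 1.\<close>
    have "strict_max_at (Suc n) f' (Suc n) (s 1)"
      using dom'[of "s 1" 1] s(3)[of 1] s(5)[of 1] s_le[of 1] assms(5) by simp
    then have "f' (Suc n) \<notin> f' ` {1..n}"
      by (fastforce simp: strict_max_at_def)
    moreover have "inj_on f' {1..n}"
      using f(2) by (subst inj_on_cong[of _ _ f]) (auto simp: f'_def)
    ultimately have inj: "inj_on f' {1..Suc n}"
      by (simp add: atLeastAtMostSuc_conv)
    have "x' k \<in> {0<..<b} \<and> strict_max_at (Suc n) f' (idx' k) (x' k)" if "k \<le> m + d" for k
    proof (cases "k \<le> m")
      case True
      \<comment> \<open>Old samples lie in [x m, b], where \<open>h\<close> is negative, so their
        maximisers are unchanged.\<close>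
      then have "apply_comega h (x k) < 0"
        using s(4)[of "x k"] x(1)[of k] x_ge[of k] by auto
      with True show ?thesis
        using strict_max_at_add_below[OF x(2) idxm] x(1) by (simp add: x'_def idx'_def f'_def)
    next
      case False
      then have "k - m \<le> d" using that by simp
      with False show ?thesis
        using dom'[of "s (k - m)" "k - m"] s(3)[of "k - m"] s(5)[of "k - m"] s_le[of "k - m"] x(1)[of m]
        by (simp add: x'_def idx'_def)
    qed
    moreover have "x' (Suc k) < x' k \<and> idx' (Suc k) \<noteq> idx' k" if "k < m + d" for k
    proof -
      consider "k < m" | "k = m" | "m < k" by linarith
      then show ?thesis
      proof cases
        case 1
        then show ?thesis using dec by (simp add: x'_def idx'_def)
      next
        case 2
        then show ?thesis using s(1) s(2)[of 0] assms(5) idxm by (simp add: x'_def idx'_def)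
      next
        case 3
        then show ?thesis
          using s(2)[of "k - m"] that idxm by (auto simp: x'_def idx'_def Suc_diff_le)
      qed
    qed
    moreover have "strict_max_at (Suc n) f' (idx' (m + d)) t" if "t \<in> {0<..x' (m + d)}" for t
    proof -
      have "t \<in> {0<..s d}"
        using that assms(5) by (simp add: x'_def)
      then show ?thesis
        using dom'[of t d] s(6)[of t] s_le[of d] assms(5) by (simp add: idx'_def)
    qed
    ultimately show ?case
      using f'L inj unfolding m
      by (intro exI[of _ f'] exI[of _ x'] exI[of _ idx'] conjI ballI allI impI) auto
  qed
  then obtain f x idx where *: "\<forall>i\<in>{1..n}. f i \<in> L" "inj_on f {1..n}"
    "\<forall>k\<le>d * (n - 1). x k \<in> {0<..<b} \<and> strict_max_at n f (idx k) (x k)"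
    "\<forall>k<d * (n - 1). x (Suc k) < x k \<and> idx (Suc k) \<noteq> idx k"
    by (elim exE conjE) blast
  show ?thesis
    by (intro exI[of _ f] exI[of _ x] exI[of _ idx]) (use * b(2) in auto)
qed

section \<open>Non-analytic points of the envelope\<close>

text \<open>Finitely many strict inequalities between continuous functions persist on a
  neighbourhood.\<close>

lemma upper_envelope_eq_near:
  assumes "strict_max_at n f i t" "t \<in> {0..1}"
  obtains e where "0 < e"
    "\<And>y. y \<in> {0..1} \<Longrightarrow> \<bar>y - t\<bar> < e \<Longrightarrow> upper_envelope n f y = apply_comega (f i) y"
proof -
  have cont: "((apply_comega g) \<longlongrightarrow> apply_comega g t) (at t within {0..1})" for g
    using comega_continuous_on[of g] assms(2) by (simp add: continuous_on_def)
  have "\<forall>\<^sub>F y in at t within {0..1}. \<forall>j\<in>{1..n} - {i}. 0 < apply_comega (f i) y - apply_comega (f j) y"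
  proof (intro eventually_ball_finite ballI)
    fix j assume "j \<in> {1..n} - {i}"
    then show "\<forall>\<^sub>F y in at t within {0..1}. 0 < apply_comega (f i) y - apply_comega (f j) y"
      using assms(1) by (intro order_tendstoD(1)[OF tendsto_diff[OF cont cont]]) (simp add: strict_max_at_def)
  qed simp
  then obtain e where e: "e > 0" "\<And>y j. y \<in> {0..1} \<Longrightarrow> y \<noteq> t \<Longrightarrow> \<bar>y - t\<bar> < e \<Longrightarrow> j \<in> {1..n} - {i} \<Longrightarrow>
      apply_comega (f j) y < apply_comega (f i) y"
    by (auto simp: eventually_at dist_real_def)
  show ?thesis
  proof
    show "0 < e" by fact
    fix y assume y: "y \<in> {0..1}" "\<bar>y - t\<bar> < e"
    have "apply_comega (f j) y \<le> apply_comega (f i) y" if "j \<in> {1..n}" for j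
    proof (cases "j = i")
      case False
      then show ?thesis
        using e(2)[of y j] y that assms(1) by (cases "y = t") (auto simp: strict_max_at_def less_imp_le)
    qed simp
    moreover have "i \<in> {1..n}" using assms(1) by (simp add: strict_max_at_def)
    ultimately show "upper_envelope n f y = apply_comega (f i) y"
      unfolding upper_envelope_def by (intro Max_eqI) auto
  qed
qed

lemma real_analytic_at_within_cong:
  assumes "0 < e" "\<And>y. y \<in> S \<Longrightarrow> \<bar>y - x\<bar> < e \<Longrightarrow> g y = f y" "real_analytic_at_within f x S"
  shows "real_analytic_at_within g x S"
proof -
  obtain r a where "r > 0" "\<forall>y\<in>S. \<bar>y - x\<bar> < r \<longrightarrow> (\<lambda>k. a k * (y - x) ^ k) sums f y"
    using assms(3) unfolding real_analytic_at_within_def by blast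
  then show ?thesis
    unfolding real_analytic_at_within_def using assms(1,2)
    by (intro exI[of _ "min r e"] conjI exI[of _ a]) auto
qed

text \<open>If the envelope were analytic on [a, b], then, since it agrees with \<open>f j\<close>
  near \<open>b\<close>, the identity theorem would make it equal to \<open>f j\<close> at
  \<open>a\<close>, where its value is the strictly larger one of \<open>f i\<close>. At
  \<open>a\<close> and \<open>b\<close> themselves it is analytic, so the bad point is
  interior.\<close>

lemma switch_point_between:
  assumes "strict_max_at n f i a" "strict_max_at n f j b" "i \<noteq> j" "0 < a" "a < b" "b < 1"
  shows "\<exists>y\<in>{a<..<b}. y \<in> non_analytic_points (upper_envelope n f)"
proof (rule ccontr)
  let ?g = "upper_envelope n f"
  assume neg: "\<not> ?thesis"
  have a: "a \<in> {0..1}" and b: "b \<in> {0..1}" using assms by auto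
  obtain e1 where e1: "0 < e1" "\<And>y. y \<in> {0..1} \<Longrightarrow> \<bar>y - a\<bar> < e1 \<Longrightarrow> ?g y = apply_comega (f i) y"
    using upper_envelope_eq_near[OF assms(1) a] by blast
  obtain e2 where e2: "0 < e2" "\<And>y. y \<in> {0..1} \<Longrightarrow> \<bar>y - b\<bar> < e2 \<Longrightarrow> ?g y = apply_comega (f j) y"
    using upper_envelope_eq_near[OF assms(2) b] by blast
  have an: "real_analytic_at_within ?g y {0..1}" if "y \<in> {a..b}" for y
  proof -
    have "y = a \<or> y = b \<or> y \<in> {a<..<b}" using that by auto
    then show ?thesis
    proof (elim disjE)
      assume "y = a"
      then show ?thesis using real_analytic_at_within_cong[OF e1 comega_analytic[OF a]] by simp
    next
      assume "y = b"
      then show ?thesis using real_analytic_at_within_cong[OF e2 comega_analytic[OF b]] by simp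
    next
      assume "y \<in> {a<..<b}"
      then show ?thesis using neg assms(4,6) by (auto simp: non_analytic_points_def)
    qed
  qed
  have "?g a - apply_comega (f j) a = 0"
  proof (rule real_analytic_identity[of a b _ b a])
    fix y assume y: "y \<in> {a..b}"
    then have "y \<in> {0..1}" using a b by auto
    then show "real_analytic_at_within (\<lambda>y. ?g y - apply_comega (f j) y) y {0..1}"
      using real_analytic_at_within_add[OF an[OF y] real_analytic_at_within_cmult[OF comega_analytic, of y "-1" "f j"]]
      by simp
  qed (use e2 assms in auto)
  moreover have "?g a = apply_comega (f i) a"
    using e1 a by simp
  moreover have "apply_comega (f j) a < apply_comega (f i) a"
    using assms(1,2,3) by (auto simp: strict_max_at_def)
  ultimately show False by simp
qed

theorem theorem4p4:
  fixes L :: "comega set" and d n :: nat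
  assumes "subspace L" and "dim L = d + 1" and "primepow n"
  shows "\<exists>f :: nat \<Rightarrow> comega. (\<forall>i\<in>{1..n}. f i \<in> L) \<and> inj_on f {1..n} \<and>
           (infinite (non_analytic_points (upper_envelope n f)) \<or>
            card (non_analytic_points (upper_envelope n f)) \<ge> d * (n - 1))"
proof -
  obtain B where B: "B \<subseteq> L" "independent B" "card B = Suc d"
    using assms(2) by (metis Suc_eq_plus1 basis_exists)
  show ?thesis
  proof (cases "d = 0")
    case True
    with B obtain g where "B = {g}"
      by (metis One_nat_def card_1_singletonE)
    with B have g: "g \<in> L" "g \<noteq> 0" by auto
    show ?thesis
      \<comment> \<open>For d = 0 the bound is 0, so \<open>n\<close> distinct elements suffice:
        multiples of one nonzero element.\<close>
      by (rule exI[of _ "\<lambda>i. real i *\<^sub>R g"])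
        (use g True assms(1) in \<open>auto simp: inj_on_def subspace_scale\<close>)
  next
    case False
    define m where "m = d * (n - 1)"
    have d: "1 \<le> d" using False by simp
    have n: "1 \<le> n" using primepow_gt_Suc_0[OF assms(3)] by simp
    obtain f x idx where f: "\<forall>i\<in>{1..n}. f i \<in> L" "inj_on f {1..n}"
      and x: "\<And>k. k \<le> m \<Longrightarrow> x k \<in> {0<..<1}" "\<And>k. k \<le> m \<Longrightarrow> strict_max_at n f (idx k) (x k)"
      and dec: "\<And>k. k < m \<Longrightarrow> x (Suc k) < x k" "\<And>k. k < m \<Longrightarrow> idx (Suc k) \<noteq> idx k"
      using exists_alternating_envelope[OF assms(1) B d n] unfolding m_def
      by (elim exE conjE) blast
    let ?N = "non_analytic_points (upper_envelope n f)"
    \<comment> \<open>One switch in each of the \<open>m\<close> gaps; the gaps are pairwise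
      disjoint because \<open>x\<close> decreases, so the chosen points are distinct.\<close>
    have "\<exists>y\<in>{x (Suc k)<..<x k}. y \<in> ?N" if "k < m" for k
      using switch_point_between[OF x(2) x(2) dec(2)[OF that] _ dec(1)[OF that]]
        x(1)[of k] x(1)[of "Suc k"] that by auto
    then obtain y where y: "\<And>k. k < m \<Longrightarrow> y k \<in> {x (Suc k)<..<x k}" "\<And>k. k < m \<Longrightarrow> y k \<in> ?N"
      by metis
    have "y l < y k" if "k < l" "l < m" for k l
      using strict_descent[of m x "Suc k" l, OF dec(1)] y(1)[of k] y(1)[of l] that by simp
    then have "inj_on y {..<m}"
      by (intro inj_onI) (metis lessThan_iff less_irrefl nat_neq_iff)
    then have "infinite ?N \<or> card {..<m} \<le> card ?N"
      using y(2) card_inj_on_le[of y "{..<m}" ?N] by blast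
    with f show ?thesis
      by (auto simp: m_def)
  qed
qed

end
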